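(* Let $\Omega\subset\mathbb{R}^n$ be open, $\mathcal{H}=L^2(\Omega)$ and $$J(u)=\begin{cases}\|u\|_{L^1(\Omega)},& u\in L^1(\Omega)\cap L^2(\Omega),\\ +\infty,&\text{else.}\end{cases}$$ Then the gradient flow $\partial_tu(t)=-p(t)$, $p(t)\in\partial J(u(t))$ with $u(0)=f$ generates a sequence of eigenvectors $p(t)$ for $t>0$, i.e. $p(t)\in\partial J(p(t))$ for all $t>0$.
   Context: The subdifferential is $\partial J(u)=\{p\in\mathcal{H}:\langle p,v\rangle\le J(v)\ \forall v\in\mathcal{H},\ \langle p,u\rangle=J(u)\}$, with $\langle\cdot,\cdot\rangle$ the $L^2(\Omega)$ inner product, and $\mathrm{dom}(\partial J)=\{u:\partial J(u)\ne\emptyset\}$. Gradient flow: for $f\in\overline{\mathrm{dom}(\partial J)}$, the solution $(u,p)$ of $\partial_tu(t)=-p(t)$, $p(t)\in\partial J(u(t))$, $u(0)=f$ is the unique continuous $u:[0,\infty)\to\mathcal{H}$ with $u(0)=f$ given by Brezis' theory (Lipschitz on $[\delta,\infty)$ for every $\delta>0$, $u(t)\in\mathrm{dom}(\partial J)$ for all $t>0$, right-differentiable at every $t>0$), together with $p(t):=-\partial_t^+u(t)$, which is the element of minimal norm in $\partial J(u(t))$ for every $t>0$. *)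

theory Defs
  imports "HOL-Analysis.Analysis"
begin

text \<open>
  Elements of \<open>L\<^sup>2(\<Omega>)\<close> are handled through their representatives: a member of \<open>L2 \<Omega>\<close> is a
  Lebesgue measurable, square integrable function on \<open>\<Omega>\<close>, whose values outside \<open>\<Omega>\<close> are irrelevant.
  All notions below are invariant under almost-everywhere equality on \<open>\<Omega>\<close>, which plays the role of
  equality in \<open>L\<^sup>2(\<Omega>)\<close>.
\<close>

definition L1 :: "'a::euclidean_space set \<Rightarrow> ('a \<Rightarrow> real) set" where
  "L1 \<Omega> = {u. integrable (lebesgue_on \<Omega>) u}"

definition L2 :: "'a::euclidean_space set \<Rightarrow> ('a \<Rightarrow> real) set" where
  "L2 \<Omega> = {u. u \<in> borel_measurable (lebesgue_on \<Omega>) \<and> integrable (lebesgue_on \<Omega>) (\<lambda>x. (u x)\<^sup>2)}"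

definition l2_inner :: "'a::euclidean_space set \<Rightarrow> ('a \<Rightarrow> real) \<Rightarrow> ('a \<Rightarrow> real) \<Rightarrow> real" where
  "l2_inner \<Omega> u v = (\<integral>x. u x * v x \<partial>lebesgue_on \<Omega>)"

definition l2_norm :: "'a::euclidean_space set \<Rightarrow> ('a \<Rightarrow> real) \<Rightarrow> real" where
  "l2_norm \<Omega> u = sqrt (l2_inner \<Omega> u u)"

definition l2_dist :: "'a::euclidean_space set \<Rightarrow> ('a \<Rightarrow> real) \<Rightarrow> ('a \<Rightarrow> real) \<Rightarrow> real" where
  "l2_dist \<Omega> u v = l2_norm \<Omega> (\<lambda>x. u x - v x)"

definition l2_closure :: "'a::euclidean_space set \<Rightarrow> ('a \<Rightarrow> real) set \<Rightarrow> ('a \<Rightarrow> real) set" where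
  "l2_closure \<Omega> A = {f \<in> L2 \<Omega>. \<forall>e>0. \<exists>g\<in>A. l2_dist \<Omega> f g < e}"

definition l1_functional :: "'a::euclidean_space set \<Rightarrow> ('a \<Rightarrow> real) \<Rightarrow> ereal" where
  "l1_functional \<Omega> u =
     (if u \<in> L1 \<Omega> \<inter> L2 \<Omega> then ereal (\<integral>x. \<bar>u x\<bar> \<partial>lebesgue_on \<Omega>) else \<infinity>)"

definition subdifferential ::
    "'a::euclidean_space set \<Rightarrow> (('a \<Rightarrow> real) \<Rightarrow> ereal) \<Rightarrow> ('a \<Rightarrow> real) \<Rightarrow> ('a \<Rightarrow> real) set" where
  "subdifferential \<Omega> J u =
     {p \<in> L2 \<Omega>. (\<forall>v\<in>L2 \<Omega>. ereal (l2_inner \<Omega> p v) \<le> J v) \<and> ereal (l2_inner \<Omega> p u) = J u}"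

definition dom_subdifferential ::
    "'a::euclidean_space set \<Rightarrow> (('a \<Rightarrow> real) \<Rightarrow> ereal) \<Rightarrow> ('a \<Rightarrow> real) set" where
  "dom_subdifferential \<Omega> J = {u \<in> L2 \<Omega>. subdifferential \<Omega> J u \<noteq> {}}"

definition has_l2_right_derivative ::
    "'a::euclidean_space set \<Rightarrow> (real \<Rightarrow> 'a \<Rightarrow> real) \<Rightarrow> ('a \<Rightarrow> real) \<Rightarrow> real \<Rightarrow> bool" where
  "has_l2_right_derivative \<Omega> u d t \<longleftrightarrow> d \<in> L2 \<Omega> \<and>
     ((\<lambda>h. l2_dist \<Omega> (\<lambda>x. (u (t + h) x - u t x) / h) d) \<longlongrightarrow> 0) (at_right 0)"

text \<open>
  The solution of \<open>\<partial>\<^sub>t u(t) = - p(t)\<close>, \<open>p(t) \<in> \<partial>J(u(t))\<close>, \<open>u(0) = f\<close> in the sense of Brezis; \<open>p\<close> is minus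
  the right derivative of \<open>u\<close>. That \<open>p(t)\<close> then has minimal norm in \<open>\<partial>J(u(t))\<close> is a consequence
  and hence not required here. Only the values \<open>u(t)\<close> for \<open>t \<ge> 0\<close> and \<open>p(t)\<close> for \<open>t > 0\<close> matter.
\<close>

definition gradient_flow_solution ::
    "'a::euclidean_space set \<Rightarrow> (('a \<Rightarrow> real) \<Rightarrow> ereal) \<Rightarrow> ('a \<Rightarrow> real) \<Rightarrow>
     (real \<Rightarrow> 'a \<Rightarrow> real) \<Rightarrow> (real \<Rightarrow> 'a \<Rightarrow> real) \<Rightarrow> bool" where
  "gradient_flow_solution \<Omega> J f u p \<longleftrightarrow>
     (\<forall>t\<ge>0. u t \<in> L2 \<Omega>) \<and>
     (AE x in lebesgue_on \<Omega>. u 0 x = f x) \<and>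
     (\<forall>t\<ge>0. ((\<lambda>s. l2_dist \<Omega> (u s) (u t)) \<longlongrightarrow> 0) (at t within {0..})) \<and>
     (\<forall>\<delta>>0. \<exists>L. \<forall>s\<ge>\<delta>. \<forall>t\<ge>\<delta>. l2_dist \<Omega> (u s) (u t) \<le> L * \<bar>s - t\<bar>) \<and>
     (\<forall>t>0. u t \<in> dom_subdifferential \<Omega> J) \<and>
     (\<forall>t>0. has_l2_right_derivative \<Omega> u (\<lambda>x. - p t x) t) \<and>
     (\<forall>t>0. p t \<in> subdifferential \<Omega> J (u t))"

end

theory Submission imports Defs begin

text \<open>
  For \<open>J = \<parallel>\<cdot>\<parallel>\<^sub>L\<^sub>1\<close> a function \<open>p\<close> lies in \<open>\<partial>J(u)\<close> only if \<open>\<bar>p\<bar> \<le> 1\<close> and \<open>p u = \<bar>u\<bar>\<close> almost everywhere, so that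
  \<open>p = \<plusminus>1\<close> wherever \<open>u \<noteq> 0\<close>, while on \<open>{u = 0}\<close> the subdifferential alone leaves \<open>p\<close> free in \<open>[-1, 1]\<close>.
  Membership \<open>p \<in> \<partial>J(p)\<close> means \<open>\<integral> p\<^sup>2 = \<integral> \<bar>p\<bar>\<close>, so it suffices that \<open>p(t)\<close> vanishes almost everywhere on
  \<open>A = {u(t) = 0}\<close>.

  This is where the dynamics enters: the flow never leaves zero once it is there. The energy
  \<open>g(s) = \<integral>\<^sub>A u(s)\<^sup>2\<close> is continuous and has right derivative \<open>-2 \<integral>\<^sub>A p(s) u(s) = -2 \<integral>\<^sub>A \<bar>u(s)\<bar> \<le> 0\<close>, hence does not
  increase (lemmas \<open>restricted_energy_upper_Dini\<close> and \<open>le_if_upper_right_Dini_nonpos\<close>). Since \<open>g(t) = 0\<close>, also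
  \<open>g(s) = 0\<close> for all \<open>s \<ge> t\<close>, so the difference quotients of \<open>u\<close> at \<open>t\<close> vanish on \<open>A\<close>, and so does their limit \<open>-p(t)\<close>.
\<close>

section \<open>The inner product space of square integrable functions\<close>

lemma L2_measurable: "u \<in> L2 \<Omega> \<Longrightarrow> u \<in> borel_measurable (lebesgue_on \<Omega>)"
  by (simp add: L2_def)

lemma L2_square_integrable: "u \<in> L2 \<Omega> \<Longrightarrow> integrable (lebesgue_on \<Omega>) (\<lambda>x. (u x)\<^sup>2)"
  by (simp add: L2_def)

lemma L2_mult_integrable:
  assumes "u \<in> L2 \<Omega>" "v \<in> L2 \<Omega>"
  shows "integrable (lebesgue_on \<Omega>) (\<lambda>x. u x * v x)"
proof (rule Bochner_Integration.integrable_bound)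
  show "integrable (lebesgue_on \<Omega>) (\<lambda>x. (u x)\<^sup>2 + (v x)\<^sup>2)"
    using assms by (simp add: L2_square_integrable)
  show "(\<lambda>x. u x * v x) \<in> borel_measurable (lebesgue_on \<Omega>)"
    using assms by (intro borel_measurable_times L2_measurable)
  have "\<bar>a * b\<bar> \<le> a\<^sup>2 + b\<^sup>2" for a b :: real
  proof -
    have "2 * (\<bar>a\<bar> * \<bar>b\<bar>) \<le> a\<^sup>2 + b\<^sup>2"
      using sum_squares_bound[of "\<bar>a\<bar>" "\<bar>b\<bar>"] by simp
    then show ?thesis
      using mult_nonneg_nonneg[of "\<bar>a\<bar>" "\<bar>b\<bar>"] unfolding abs_mult by linarith
  qed
  then show "AE x in lebesgue_on \<Omega>. norm (u x * v x) \<le> norm ((u x)\<^sup>2 + (v x)\<^sup>2)"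
    by simp
qed

lemma L2_scale: "u \<in> L2 \<Omega> \<Longrightarrow> (\<lambda>x. c * u x) \<in> L2 \<Omega>"
  by (auto simp: L2_def power_mult_distrib)

lemma L2_add:
  assumes "u \<in> L2 \<Omega>" "v \<in> L2 \<Omega>"
  shows "(\<lambda>x. u x + v x) \<in> L2 \<Omega>"
proof -
  have "integrable (lebesgue_on \<Omega>) (\<lambda>x. (u x)\<^sup>2 + (v x)\<^sup>2 + 2 * (u x * v x))"
    using assms by (intro Bochner_Integration.integrable_add integrable_mult_right
        L2_square_integrable L2_mult_integrable)
  then show ?thesis
    using assms by (auto simp: L2_def power2_sum mult.assoc)
qed

lemma L2_diff:
  assumes "u \<in> L2 \<Omega>" "v \<in> L2 \<Omega>"
  shows "(\<lambda>x. u x - v x) \<in> L2 \<Omega>"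
  using L2_add[OF assms(1) L2_scale[OF assms(2), of "-1"]] by simp

lemma L2_restrict:
  assumes "u \<in> L2 \<Omega>" "A \<in> sets (lebesgue_on \<Omega>)"
  shows "(\<lambda>x. indicat_real A x * u x) \<in> L2 \<Omega>"
proof -
  have "integrable (lebesgue_on \<Omega>) (\<lambda>x. (indicat_real A x * u x)\<^sup>2)"
    by (rule Bochner_Integration.integrable_bound[OF L2_square_integrable[OF assms(1)]])
       (use assms in \<open>auto simp: L2_def indicator_def\<close>)
  then show ?thesis
    using assms by (auto simp: L2_def)
qed

lemma l2_inner_add_left:
  assumes "u \<in> L2 \<Omega>" "v \<in> L2 \<Omega>" "w \<in> L2 \<Omega>"
  shows "l2_inner \<Omega> (\<lambda>x. u x + v x) w = l2_inner \<Omega> u w + l2_inner \<Omega> v w"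
  using assms by (simp add: l2_inner_def distrib_right L2_mult_integrable)

lemma l2_inner_diff_left:
  assumes "u \<in> L2 \<Omega>" "v \<in> L2 \<Omega>" "w \<in> L2 \<Omega>"
  shows "l2_inner \<Omega> (\<lambda>x. u x - v x) w = l2_inner \<Omega> u w - l2_inner \<Omega> v w"
  using assms by (simp add: l2_inner_def left_diff_distrib L2_mult_integrable)

lemma l2_inner_commute: "l2_inner \<Omega> u v = l2_inner \<Omega> v u"
  by (simp add: l2_inner_def mult.commute)

lemma l2_inner_self_nonneg: "0 \<le> l2_inner \<Omega> u u"
  by (simp add: l2_inner_def)

lemma l2_inner_self_add_scale:
  assumes "u \<in> L2 \<Omega>" "v \<in> L2 \<Omega>"
  shows "l2_inner \<Omega> (\<lambda>x. u x + c * v x) (\<lambda>x. u x + c * v x)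
    = l2_inner \<Omega> u u + 2 * c * l2_inner \<Omega> u v + c\<^sup>2 * l2_inner \<Omega> v v"
proof -
  have "(\<lambda>x. (u x + c * v x) * (u x + c * v x))
      = (\<lambda>x. u x * u x + 2 * c * (u x * v x) + c\<^sup>2 * (v x * v x))"
    by (rule ext) (simp add: algebra_simps power2_eq_square)
  then show ?thesis
    using L2_mult_integrable[OF assms(1,1)] L2_mult_integrable[OF assms]
      L2_mult_integrable[OF assms(2,2)]
    by (simp add: l2_inner_def)
qed

lemma l2_norm_nonneg: "0 \<le> l2_norm \<Omega> u"
  by (simp add: l2_norm_def l2_inner_self_nonneg)

lemma l2_norm_square: "(l2_norm \<Omega> u)\<^sup>2 = l2_inner \<Omega> u u"
  by (simp add: l2_norm_def l2_inner_self_nonneg)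

lemma l2_norm_eq_0_iff:
  assumes "u \<in> L2 \<Omega>"
  shows "l2_norm \<Omega> u = 0 \<longleftrightarrow> (AE x in lebesgue_on \<Omega>. u x = 0)"
  using integral_nonneg_eq_0_iff_AE[OF L2_mult_integrable[OF assms assms]]
  by (simp add: l2_norm_def l2_inner_def)

lemma l2_Cauchy_Schwarz:
  assumes u: "u \<in> L2 \<Omega>" and v: "v \<in> L2 \<Omega>"
  shows "\<bar>l2_inner \<Omega> u v\<bar> \<le> l2_norm \<Omega> u * l2_norm \<Omega> v"
proof (cases "l2_norm \<Omega> v = 0")
  case True
  then have "AE x in lebesgue_on \<Omega>. u x * v x = 0"
    using l2_norm_eq_0_iff[OF v] by auto
  then have "l2_inner \<Omega> u v = 0"
    unfolding l2_inner_def by (rule integral_eq_zero_AE)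
  then show ?thesis
    using True by simp
next
  case False
  \<comment> \<open>\<open>u + c v\<close> is the component of \<open>u\<close> orthogonal to \<open>v\<close>.\<close>
  define c where "c = - l2_inner \<Omega> u v / l2_inner \<Omega> v v"
  have vv: "0 < l2_inner \<Omega> v v"
    using False l2_norm_square[of \<Omega> v] by (metis l2_inner_self_nonneg less_eq_real_def zero_eq_power2)
  have "0 \<le> l2_inner \<Omega> (\<lambda>x. u x + c * v x) (\<lambda>x. u x + c * v x)"
    by (rule l2_inner_self_nonneg)
  also have "\<dots> = l2_inner \<Omega> u u + 2 * c * l2_inner \<Omega> u v + c\<^sup>2 * l2_inner \<Omega> v v"
    by (rule l2_inner_self_add_scale[OF u v])
  also have "\<dots> = l2_inner \<Omega> u u - (l2_inner \<Omega> u v)\<^sup>2 / l2_inner \<Omega> v v"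
    using vv by (simp add: c_def field_simps power2_eq_square)
  finally have "(l2_inner \<Omega> u v)\<^sup>2 \<le> l2_inner \<Omega> u u * l2_inner \<Omega> v v"
    using vv by (simp add: field_simps)
  then have "(l2_inner \<Omega> u v)\<^sup>2 \<le> (l2_norm \<Omega> u * l2_norm \<Omega> v)\<^sup>2"
    by (simp add: power_mult_distrib l2_norm_square)
  then show ?thesis
    by (metis abs_le_square_iff abs_of_nonneg l2_norm_nonneg mult_nonneg_nonneg)
qed

lemma l2_norm_triangle:
  assumes u: "u \<in> L2 \<Omega>" and v: "v \<in> L2 \<Omega>"
  shows "l2_norm \<Omega> (\<lambda>x. u x + v x) \<le> l2_norm \<Omega> u + l2_norm \<Omega> v"
proof (rule power2_le_imp_le)
  have "(l2_norm \<Omega> (\<lambda>x. u x + v x))\<^sup>2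
      = l2_inner \<Omega> u u + 2 * l2_inner \<Omega> u v + l2_inner \<Omega> v v"
    using l2_inner_self_add_scale[OF u v, of 1] by (simp add: l2_norm_square)
  also have "\<dots> \<le> l2_inner \<Omega> u u + 2 * (l2_norm \<Omega> u * l2_norm \<Omega> v) + l2_inner \<Omega> v v"
    using l2_Cauchy_Schwarz[OF u v] by simp
  also have "\<dots> = (l2_norm \<Omega> u + l2_norm \<Omega> v)\<^sup>2"
    by (simp add: power2_sum l2_norm_square)
  finally show "(l2_norm \<Omega> (\<lambda>x. u x + v x))\<^sup>2 \<le> (l2_norm \<Omega> u + l2_norm \<Omega> v)\<^sup>2" .
qed (simp add: l2_norm_nonneg)

lemma l2_norm_mono_AE:
  assumes "u \<in> L2 \<Omega>" "v \<in> L2 \<Omega>" "AE x in lebesgue_on \<Omega>. \<bar>u x\<bar> \<le> \<bar>v x\<bar>"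
  shows "l2_norm \<Omega> u \<le> l2_norm \<Omega> v"
proof -
  have "AE x in lebesgue_on \<Omega>. u x * u x \<le> v x * v x"
    using assms(3) by eventually_elim (metis abs_le_square_iff power2_eq_square)
  then show ?thesis
    using assms unfolding l2_norm_def l2_inner_def
    by (intro real_sqrt_le_mono integral_mono_AE L2_mult_integrable)
qed

lemma l2_norm_restrict_le:
  assumes "u \<in> L2 \<Omega>" "A \<in> sets (lebesgue_on \<Omega>)"
  shows "l2_norm \<Omega> (\<lambda>x. indicat_real A x * u x) \<le> l2_norm \<Omega> u"
  by (rule l2_norm_mono_AE[OF L2_restrict[OF assms] assms(1)]) (auto simp: indicator_def)

lemma l2_dist_commute: "l2_dist \<Omega> u v = l2_dist \<Omega> v u"
  by (simp add: l2_dist_def l2_norm_def l2_inner_def algebra_simps)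

lemma l2_norm_restrict_dist:
  assumes u: "u \<in> L2 \<Omega>" and v: "v \<in> L2 \<Omega>" and A: "A \<in> sets (lebesgue_on \<Omega>)"
  shows "\<bar>l2_norm \<Omega> (\<lambda>x. indicat_real A x * u x) - l2_norm \<Omega> (\<lambda>x. indicat_real A x * v x)\<bar>
    \<le> l2_dist \<Omega> u v"
proof -
  have *: "l2_norm \<Omega> (\<lambda>x. indicat_real A x * u x)
      \<le> l2_norm \<Omega> (\<lambda>x. indicat_real A x * v x) + l2_dist \<Omega> u v"
    if u: "u \<in> L2 \<Omega>" and v: "v \<in> L2 \<Omega>" for u v
  proof -
    note d = L2_diff[OF u v]
    have "l2_norm \<Omega> (\<lambda>x. indicat_real A x * u x)
        = l2_norm \<Omega> (\<lambda>x. indicat_real A x * v x + indicat_real A x * (u x - v x))"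
      by (simp add: algebra_simps)
    also have "\<dots> \<le> l2_norm \<Omega> (\<lambda>x. indicat_real A x * v x)
        + l2_norm \<Omega> (\<lambda>x. indicat_real A x * (u x - v x))"
      by (rule l2_norm_triangle[OF L2_restrict[OF v A] L2_restrict[OF d A]])
    also have "l2_norm \<Omega> (\<lambda>x. indicat_real A x * (u x - v x)) \<le> l2_dist \<Omega> u v"
      unfolding l2_dist_def by (rule l2_norm_restrict_le[OF d A])
    finally show ?thesis by simp
  qed
  show ?thesis
    using *[OF u v] *[OF v u] by (simp add: l2_dist_commute[of \<Omega> v u] abs_le_iff)
qed

section \<open>Subgradients of the \<open>L\<^sup>1\<close> norm\<close>

text \<open>
  Testing with \<open>v = sgn p\<close> on \<open>{\<bar>p\<bar> > 1}\<close>, a set of finite measure since \<open>p\<close> is square integrable, yields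
  \<open>\<integral> (\<bar>p\<bar> - 1) \<le> 0\<close> over that set.
\<close>

lemma l1_polar_abs_le_1:
  assumes p: "p \<in> L2 \<Omega>"
    and le: "\<And>v. v \<in> L2 \<Omega> \<Longrightarrow> ereal (l2_inner \<Omega> p v) \<le> l1_functional \<Omega> v"
  shows "AE x in lebesgue_on \<Omega>. \<bar>p x\<bar> \<le> 1"
proof -
  define v where "v x = (if 1 < \<bar>p x\<bar> then sgn (p x) else 0)" for x
  have pm [measurable]: "p \<in> borel_measurable (lebesgue_on \<Omega>)"
    by (rule L2_measurable[OF p])
  have vm [measurable]: "v \<in> borel_measurable (lebesgue_on \<Omega>)"
    unfolding v_def by measurable
  have bound: "\<bar>v x\<bar> \<le> (p x)\<^sup>2" for x
  proof (cases "1 < \<bar>p x\<bar>")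
    case True
    then have "1 \<le> (p x)\<^sup>2"
      using one_le_power[of "\<bar>p x\<bar>" 2] by simp
    then show ?thesis
      using True by (auto simp: v_def sgn_if)
  qed (simp add: v_def)
  have v_sq: "(v x)\<^sup>2 = \<bar>v x\<bar>" for x
    by (simp add: v_def sgn_if)
  have vint: "integrable (lebesgue_on \<Omega>) v"
    by (rule Bochner_Integration.integrable_bound[OF L2_square_integrable[OF p]]) (use bound in auto)
  then have v1: "v \<in> L1 \<Omega>" and v2: "v \<in> L2 \<Omega>"
    by (simp_all add: L1_def L2_def v_sq integrable_abs)
  have pv: "integrable (lebesgue_on \<Omega>) (\<lambda>x. p x * v x)"
    by (rule L2_mult_integrable[OF p v2])
  have "l2_inner \<Omega> p v \<le> (\<integral>x. \<bar>v x\<bar> \<partial>lebesgue_on \<Omega>)"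
    using le[OF v2] v1 v2 by (simp add: l1_functional_def)
  then have int_le: "(\<integral>x. p x * v x - \<bar>v x\<bar> \<partial>lebesgue_on \<Omega>) \<le> 0"
    using pv vint by (simp add: l2_inner_def)
  have nonneg: "0 \<le> p x * v x - \<bar>v x\<bar>" for x
    by (auto simp: v_def sgn_if)
  then have "(\<integral>x. p x * v x - \<bar>v x\<bar> \<partial>lebesgue_on \<Omega>) = 0"
    using int_le by (intro antisym) (auto intro!: integral_nonneg_AE)
  then have "AE x in lebesgue_on \<Omega>. p x * v x - \<bar>v x\<bar> = 0"
    using nonneg pv vint by (subst (asm) integral_nonneg_eq_0_iff_AE) auto
  then show ?thesis
    by eventually_elim (auto simp: v_def sgn_if split: if_splits)
qed

text \<open>
  Given the pointwise bound \<open>\<bar>p\<bar> \<le> 1\<close>, the function \<open>\<bar>u\<bar> - p u\<close> is nonnegative, and \<open>\<langle>p, u\<rangle> = J(u)\<close> says that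
  its integral is zero.
\<close>

lemma l1_subgradient_AE:
  assumes p: "p \<in> subdifferential \<Omega> (l1_functional \<Omega>) u" and u: "u \<in> L2 \<Omega>"
  shows "AE x in lebesgue_on \<Omega>. \<bar>p x\<bar> \<le> 1" (is ?bound)
    and "AE x in lebesgue_on \<Omega>. p x * u x = \<bar>u x\<bar>" (is ?sign)
proof -
  have p2: "p \<in> L2 \<Omega>" and eq: "ereal (l2_inner \<Omega> p u) = l1_functional \<Omega> u"
    and le: "\<And>v. v \<in> L2 \<Omega> \<Longrightarrow> ereal (l2_inner \<Omega> p v) \<le> l1_functional \<Omega> v"
    using p by (auto simp: subdifferential_def)
  show b: ?bound
    by (rule l1_polar_abs_le_1[OF p2 le])
  have uint: "integrable (lebesgue_on \<Omega>) u"
    and int_eq: "(\<integral>x. p x * u x \<partial>lebesgue_on \<Omega>) = (\<integral>x. \<bar>u x\<bar> \<partial>lebesgue_on \<Omega>)"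
    using eq by (auto simp: l1_functional_def L1_def l2_inner_def split: if_splits)
  note pu = L2_mult_integrable[OF p2 u]
  have nonneg: "AE x in lebesgue_on \<Omega>. 0 \<le> \<bar>u x\<bar> - p x * u x"
    using b
  proof eventually_elim
    case (elim x)
    have "p x * u x \<le> \<bar>p x\<bar> * \<bar>u x\<bar>"
      by (metis abs_ge_self abs_mult)
    also have "\<dots> \<le> \<bar>u x\<bar>"
      using elim by (simp add: mult_left_le_one_le)
    finally show ?case by simp
  qed
  have "(\<integral>x. \<bar>u x\<bar> - p x * u x \<partial>lebesgue_on \<Omega>) = 0"
    using int_eq uint pu by simp
  then have "AE x in lebesgue_on \<Omega>. \<bar>u x\<bar> - p x * u x = 0"
    using integral_nonneg_eq_0_iff_AE[OF _ nonneg] uint pu by auto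
  then show ?sign
    by eventually_elim simp
qed

text \<open>
  The bound \<open>\<langle>p, v\<rangle> \<le> J(v)\<close> does not refer to the point at which \<open>p\<close> is a subgradient, so being an eigenvector
  only concerns the values of \<open>p\<close>.
\<close>

lemma l1_subgradient_is_eigenvector:
  assumes p: "p \<in> subdifferential \<Omega> (l1_functional \<Omega>) u"
    and sq: "AE x in lebesgue_on \<Omega>. (p x)\<^sup>2 = \<bar>p x\<bar>"
  shows "p \<in> subdifferential \<Omega> (l1_functional \<Omega>) p"
proof -
  have p2: "p \<in> L2 \<Omega>"
    using p by (simp add: subdifferential_def)
  have pm [measurable]: "p \<in> borel_measurable (lebesgue_on \<Omega>)"
    by (rule L2_measurable[OF p2])
  have "integrable (lebesgue_on \<Omega>) p"
    by (rule Bochner_Integration.integrable_bound[OF L2_square_integrable[OF p2]]) (use sq in auto)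
  moreover have "(\<integral>x. (p x)\<^sup>2 \<partial>lebesgue_on \<Omega>) = (\<integral>x. \<bar>p x\<bar> \<partial>lebesgue_on \<Omega>)"
    by (rule integral_cong_AE) (use sq in auto)
  ultimately have "ereal (l2_inner \<Omega> p p) = l1_functional \<Omega> p"
    using p2 by (simp add: l1_functional_def L1_def l2_inner_def power2_eq_square)
  then show ?thesis
    using p by (simp add: subdifferential_def)
qed

section \<open>Decay of the energy on a fixed set\<close>

text \<open>
  Let \<open>k(s) = g(s) - e (s - a)\<close> with \<open>e > 0\<close>, and let \<open>c\<close> be the last point of \<open>[a, b]\<close> with \<open>k(c) \<le> k(a)\<close>, which
  exists by continuity. If \<open>c < b\<close>, the derivative bound at \<open>c\<close> yields later points with \<open>k \<le> k(c)\<close>. So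
  \<open>c = b\<close>, and it remains to let \<open>e\<close> tend to zero.
\<close>

lemma le_if_upper_right_Dini_nonpos:
  fixes g :: "real \<Rightarrow> real"
  assumes "a \<le> b" and cont: "continuous_on {a..b} g"
    and dini: "\<And>s e. a \<le> s \<Longrightarrow> s < b \<Longrightarrow> 0 < e \<Longrightarrow> \<forall>\<^sub>F h in at_right 0. g (s + h) \<le> g s + e * h"
  shows "g b \<le> g a"
proof (rule field_le_epsilon)
  fix d :: real
  assume "0 < d"
  \<comment> \<open>The summand \<open>1\<close> covers the case \<open>a = b\<close>.\<close>
  define e where "e = d / (b - a + 1)"
  have e: "0 < e" and ed: "e * (b - a) \<le> d"
    using \<open>0 < d\<close> \<open>a \<le> b\<close> by (auto simp: e_def field_simps)
  define k where "k s = g s - e * (s - a)" for s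
  define S where "S = {s \<in> {a..b}. k s \<le> k a}"
  have "continuous_on {a..b} k"
    unfolding k_def by (intro continuous_intros cont)
  then have "closed S"
    unfolding S_def by (intro continuous_on_closed_Collect_le continuous_intros) auto
  then have "compact ({a..b} \<inter> S)"
    by (intro compact_Int_closed compact_Icc)
  then have "compact S"
    by (simp add: S_def Int_def conj_ac)
  moreover have "a \<in> S"
    using \<open>a \<le> b\<close> by (simp add: S_def)
  ultimately obtain c where c: "c \<in> S" and c_max: "\<And>s. s \<in> S \<Longrightarrow> s \<le> c"
    using compact_attains_sup[of S] by blast
  have "c = b"
  proof (rule ccontr)
    assume "c \<noteq> b"
    then have cb: "a \<le> c" "c < b"
      using c by (auto simp: S_def)
    have "\<forall>\<^sub>F h in at_right 0. h < b - c"
      using cb by (intro eventually_at_right_less[THEN eventually_mono] order_tendstoD) auto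
    then have "\<forall>\<^sub>F h in at_right 0. 0 < h \<and> h < b - c \<and> g (c + h) \<le> g c + e * h"
      using dini[OF cb e] eventually_at_right_less[of 0] by eventually_elim auto
    then obtain h where h: "0 < h" "h < b - c" "g (c + h) \<le> g c + e * h"
      using eventually_happens' trivial_limit_at_right_real by blast
    then have "k (c + h) \<le> k c"
      by (simp add: k_def algebra_simps)
    then have "c + h \<in> S"
      using c h cb by (auto simp: S_def)
    then show False
      using c_max h by fastforce
  qed
  then have "k b \<le> k a"
    using c by (simp add: S_def)
  then show "g b \<le> g a + d"
    using ed by (simp add: k_def)
qed

text \<open>
  With \<open>D\<close> the difference quotient and all integrals over \<open>A\<close>, the pointwise inequality \<open>a\<^sup>2 - b\<^sup>2 \<le> 2 (a - b) a\<close>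
  bounds the increment of the energy by \<open>2 h \<langle>D, u(s + h)\<rangle>\<close>. Replacing \<open>D\<close> by its limit \<open>-p\<close> and then \<open>u(s + h)\<close>
  by \<open>u(s)\<close> costs errors that tend to zero, and \<open>-\<langle>p, u(s)\<rangle> \<le> 0\<close>.
\<close>

lemma restricted_energy_upper_Dini:
  fixes u :: "real \<Rightarrow> 'a::euclidean_space \<Rightarrow> real"
  assumes A: "A \<in> sets (lebesgue_on \<Omega>)"
    and uL: "\<And>r. s \<le> r \<Longrightarrow> u r \<in> L2 \<Omega>"
    and pL: "p \<in> L2 \<Omega>"
    and deriv: "has_l2_right_derivative \<Omega> u (\<lambda>x. - p x) s"
    and cont: "((\<lambda>h. l2_dist \<Omega> (u (s + h)) (u s)) \<longlongrightarrow> 0) (at_right 0)"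
    and pu: "AE x in lebesgue_on \<Omega>. 0 \<le> p x * u s x"
    and "0 < e"
  shows "\<forall>\<^sub>F h in at_right 0. (l2_norm \<Omega> (\<lambda>x. indicat_real A x * u (s + h) x))\<^sup>2
    \<le> (l2_norm \<Omega> (\<lambda>x. indicat_real A x * u s x))\<^sup>2 + e * h"
proof -
  let ?w = "\<lambda>r x. indicat_real A x * u r x"
  define E where "E h = l2_dist \<Omega> (\<lambda>x. (u (s + h) x - u s x) / h) (\<lambda>x. - p x)" for h
  define d where "d h = l2_dist \<Omega> (u (s + h)) (u s)" for h
  define err where "err h = 2 * (E h * (l2_norm \<Omega> (?w s) + d h) + l2_norm \<Omega> p * d h)" for h
  have "(E \<longlongrightarrow> 0) (at_right 0)"
    using deriv unfolding E_def has_l2_right_derivative_def by simp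
  moreover have "(d \<longlongrightarrow> 0) (at_right 0)"
    using cont unfolding d_def .
  ultimately have "(err \<longlongrightarrow> 2 * (0 * (l2_norm \<Omega> (?w s) + 0) + l2_norm \<Omega> p * 0)) (at_right 0)"
    unfolding err_def by (intro tendsto_intros)
  then have "\<forall>\<^sub>F h in at_right 0. err h < e"
    using \<open>0 < e\<close> by (intro order_tendstoD) auto
  then show ?thesis
    using eventually_at_right_less[of 0]
  proof eventually_elim
    case (elim h)
    define D where "D x = (u (s + h) x - u s x) / h" for x
    have us: "u s \<in> L2 \<Omega>" and ush: "u (s + h) \<in> L2 \<Omega>"
      using uL elim by auto
    note ws = L2_restrict[OF us A] and wsh = L2_restrict[OF ush A]
    note diff = L2_diff[OF ush us]
    have DL: "D \<in> L2 \<Omega>"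
      using L2_scale[OF diff, of "1 / h"] by (simp add: D_def[abs_def])
    have DpL: "(\<lambda>x. D x + p x) \<in> L2 \<Omega>"
      by (rule L2_add[OF DL pL])
    have E_eq: "E h = l2_norm \<Omega> (\<lambda>x. D x + p x)"
      by (simp add: E_def l2_dist_def D_def)
    have main: "(l2_norm \<Omega> (?w (s + h)))\<^sup>2 - (l2_norm \<Omega> (?w s))\<^sup>2
        \<le> 2 * h * l2_inner \<Omega> D (?w (s + h))"
    proof -
      have "(l2_norm \<Omega> (?w (s + h)))\<^sup>2 - (l2_norm \<Omega> (?w s))\<^sup>2
          = (\<integral>x. ?w (s + h) x * ?w (s + h) x - ?w s x * ?w s x \<partial>lebesgue_on \<Omega>)"
        unfolding l2_norm_square l2_inner_def
        by (rule Bochner_Integration.integral_diff[symmetric]) (intro L2_mult_integrable ws wsh)+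
      also have "\<dots> \<le> (\<integral>x. 2 * h * (D x * ?w (s + h) x) \<partial>lebesgue_on \<Omega>)"
      proof (rule integral_mono)
        show "integrable (lebesgue_on \<Omega>) (\<lambda>x. ?w (s + h) x * ?w (s + h) x - ?w s x * ?w s x)"
          by (intro Bochner_Integration.integrable_diff L2_mult_integrable ws wsh)
        show "integrable (lebesgue_on \<Omega>) (\<lambda>x. 2 * h * (D x * ?w (s + h) x))"
          by (intro integrable_mult_right L2_mult_integrable DL wsh)
        have "a * a - b * b \<le> 2 * ((a - b) * a)" for a b :: real
          using zero_le_square[of "a - b"] by (simp add: algebra_simps)
        then show "?w (s + h) x * ?w (s + h) x - ?w s x * ?w s x \<le> 2 * h * (D x * ?w (s + h) x)" for x
          using elim by (simp add: D_def indicator_def)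
      qed
      finally show ?thesis
        by (simp add: l2_inner_def)
    qed
    have pos: "0 \<le> l2_inner \<Omega> p (?w s)"
      unfolding l2_inner_def
      by (rule integral_nonneg_AE) (use pu in \<open>eventually_elim, simp add: indicator_def\<close>)
    have Dp: "l2_inner \<Omega> (\<lambda>x. D x + p x) (?w (s + h)) \<le> E h * (l2_norm \<Omega> (?w s) + d h)"
    proof -
      have "l2_inner \<Omega> (\<lambda>x. D x + p x) (?w (s + h)) \<le> E h * l2_norm \<Omega> (?w (s + h))"
        using l2_Cauchy_Schwarz[OF DpL wsh] by (simp add: E_eq)
      also have "\<dots> \<le> E h * (l2_norm \<Omega> (?w s) + d h)"
        using l2_norm_restrict_dist[OF ush us A]
        by (intro mult_left_mono) (auto simp: d_def E_eq l2_norm_nonneg)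
      finally show ?thesis .
    qed
    have pd: "l2_inner \<Omega> p (?w s) - l2_inner \<Omega> p (?w (s + h)) \<le> l2_norm \<Omega> p * d h"
    proof -
      have "l2_inner \<Omega> p (?w s) - l2_inner \<Omega> p (?w (s + h))
          = - l2_inner \<Omega> p (\<lambda>x. ?w (s + h) x - ?w s x)"
        using l2_inner_diff_left[OF wsh ws pL] by (simp add: l2_inner_commute[of \<Omega> p])
      also have "\<dots> = - l2_inner \<Omega> p (\<lambda>x. indicat_real A x * (u (s + h) x - u s x))"
        by (simp add: right_diff_distrib)
      also have "\<dots> \<le> l2_norm \<Omega> p * l2_norm \<Omega> (\<lambda>x. indicat_real A x * (u (s + h) x - u s x))"
        using l2_Cauchy_Schwarz[OF pL L2_restrict[OF diff A]] by simp
      also have "\<dots> \<le> l2_norm \<Omega> p * d h"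
        unfolding d_def l2_dist_def
        by (intro mult_left_mono l2_norm_restrict_le[OF diff A] l2_norm_nonneg)
      finally show ?thesis .
    qed
    have "l2_inner \<Omega> D (?w (s + h))
        = l2_inner \<Omega> (\<lambda>x. D x + p x) (?w (s + h)) - l2_inner \<Omega> p (?w (s + h))"
      using l2_inner_add_left[OF DL pL wsh] by simp
    then have "2 * l2_inner \<Omega> D (?w (s + h)) \<le> err h"
      using Dp pd pos by (simp add: err_def)
    then have "2 * l2_inner \<Omega> D (?w (s + h)) \<le> e"
      using elim by simp
    then have "2 * l2_inner \<Omega> D (?w (s + h)) * h \<le> e * h"
      using elim by (intro mult_right_mono) auto
    then show ?case
      using main by (simp add: mult_ac)
  qed
qed

section \<open>The flow of the \<open>L\<^sup>1\<close> norm\<close>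

text \<open>
  The energy of \<open>u(s)\<close> on the set \<open>A = {u(t) = 0}\<close> starts from \<open>0\<close> at \<open>s = t\<close> and does not increase, because
  \<open>p(s) u(s) = \<bar>u(s)\<bar> \<ge> 0\<close>.
\<close>

lemma l1_flow_stays_zero:
  fixes u p :: "real \<Rightarrow> 'a::euclidean_space \<Rightarrow> real"
  assumes flow: "gradient_flow_solution \<Omega> (l1_functional \<Omega>) f u p"
    and t: "0 < t" "t \<le> b"
  shows "AE x in lebesgue_on \<Omega>. u t x = 0 \<longrightarrow> u b x = 0"
proof -
  have uL: "u r \<in> L2 \<Omega>" if "0 \<le> r" for r
    using flow that by (simp add: gradient_flow_solution_def)
  have cont: "((\<lambda>s. l2_dist \<Omega> (u s) (u r)) \<longlongrightarrow> 0) (at r within {0..})" if "0 \<le> r" for r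
    using flow that by (simp add: gradient_flow_solution_def)
  have [measurable]: "u t \<in> borel_measurable (lebesgue_on \<Omega>)"
    using t by (intro L2_measurable uL) simp
  define A where "A = {x \<in> space (lebesgue_on \<Omega>). u t x = 0}"
  have A: "A \<in> sets (lebesgue_on \<Omega>)"
    unfolding A_def by measurable
  define \<phi> where "\<phi> r = l2_norm \<Omega> (\<lambda>x. indicat_real A x * u r x)" for r
  have "(\<phi> b)\<^sup>2 \<le> (\<phi> t)\<^sup>2"
  proof (rule le_if_upper_right_Dini_nonpos[OF t(2)])
    have "(\<phi> \<longlongrightarrow> \<phi> r) (at r within {t..b})" if r: "r \<in> {t..b}" for r
    proof -
      have "((\<lambda>s. l2_dist \<Omega> (u s) (u r)) \<longlongrightarrow> 0) (at r within {t..b})"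
        using r t by (intro tendsto_within_subset[OF cont]) auto
      moreover have "\<forall>\<^sub>F s in at r within {t..b}. norm (\<phi> s - \<phi> r) \<le> l2_dist \<Omega> (u s) (u r)"
        unfolding eventually_at_filter \<phi>_def real_norm_def
        using r t by (intro always_eventually allI impI l2_norm_restrict_dist uL A) auto
      ultimately have "((\<lambda>s. \<phi> s - \<phi> r) \<longlongrightarrow> 0) (at r within {t..b})"
        by (rule Lim_null_comparison[rotated])
      then show ?thesis
        by (simp add: Lim_null[of \<phi>])
    qed
    then show "continuous_on {t..b} (\<lambda>r. (\<phi> r)\<^sup>2)"
      by (intro continuous_on_power) (simp add: continuous_on_def)
  next
    fix s e :: real
    assume s: "t \<le> s" and e: "0 < e"
    have s0: "0 < s"
      using s t by simp
    have ps: "p s \<in> subdifferential \<Omega> (l1_functional \<Omega>) (u s)"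
      and ds: "has_l2_right_derivative \<Omega> u (\<lambda>x. - p s x) s"
      using flow s0 by (simp_all add: gradient_flow_solution_def)
    have pu: "AE x in lebesgue_on \<Omega>. 0 \<le> p s x * u s x"
      using l1_subgradient_AE(2)[OF ps uL] s0 by auto
    have "((\<lambda>r. l2_dist \<Omega> (u r) (u s)) \<longlongrightarrow> 0) (at_right s)"
      using s0 by (intro tendsto_within_subset[OF cont]) auto
    then have cs: "((\<lambda>h. l2_dist \<Omega> (u (s + h)) (u s)) \<longlongrightarrow> 0) (at_right 0)"
      by (subst (asm) filterlim_at_right_to_0) (simp add: add.commute)
    show "\<forall>\<^sub>F h in at_right 0. (\<phi> (s + h))\<^sup>2 \<le> (\<phi> s)\<^sup>2 + e * h"
      unfolding \<phi>_def
      by (rule restricted_energy_upper_Dini[OF A _ _ ds cs pu e])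
         (use s0 ps in \<open>auto intro: uL simp: subdifferential_def\<close>)
  qed
  moreover have "\<phi> t = 0"
    unfolding \<phi>_def
    by (subst l2_norm_eq_0_iff[OF L2_restrict[OF uL A]]) (use t in \<open>auto simp: A_def indicator_def\<close>)
  ultimately have "\<phi> b = 0"
    by simp
  then have "AE x in lebesgue_on \<Omega>. indicat_real A x * u b x = 0"
    unfolding \<phi>_def by (subst (asm) l2_norm_eq_0_iff[OF L2_restrict[OF uL A]]) (use t in auto)
  then show ?thesis
    using AE_space by eventually_elim (auto simp: A_def)
qed

text \<open>
  On \<open>A = {u(t) = 0}\<close> every forward difference quotient at \<open>t\<close> vanishes, so the \<open>L\<^sup>2(A)\<close> norm of \<open>p(t)\<close> is at most
  the distance of the difference quotient from \<open>-p(t)\<close>, which tends to zero.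
\<close>

lemma l1_flow_velocity_zero:
  fixes u p :: "real \<Rightarrow> 'a::euclidean_space \<Rightarrow> real"
  assumes flow: "gradient_flow_solution \<Omega> (l1_functional \<Omega>) f u p" and t: "0 < t"
  shows "AE x in lebesgue_on \<Omega>. u t x = 0 \<longrightarrow> p t x = 0"
proof -
  have uL: "u r \<in> L2 \<Omega>" if "0 \<le> r" for r
    using flow that by (simp add: gradient_flow_solution_def)
  have pL: "p t \<in> L2 \<Omega>"
    using flow t by (simp add: gradient_flow_solution_def subdifferential_def)
  have [measurable]: "u t \<in> borel_measurable (lebesgue_on \<Omega>)"
    using t by (intro L2_measurable uL) simp
  define A where "A = {x \<in> space (lebesgue_on \<Omega>). u t x = 0}"
  have A: "A \<in> sets (lebesgue_on \<Omega>)"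
    unfolding A_def by measurable
  note wL = L2_restrict[OF pL A]
  let ?E = "\<lambda>h. l2_dist \<Omega> (\<lambda>x. (u (t + h) x - u t x) / h) (\<lambda>x. - p t x)"
  have "(?E \<longlongrightarrow> 0) (at_right 0)"
    using flow t by (simp add: gradient_flow_solution_def has_l2_right_derivative_def)
  moreover have "\<forall>\<^sub>F h in at_right 0. l2_norm \<Omega> (\<lambda>x. indicat_real A x * p t x) \<le> ?E h"
    using eventually_at_right_less[of 0]
  proof eventually_elim
    case (elim h)
    have "(\<lambda>x. (u (t + h) x - u t x) / h + p t x) \<in> L2 \<Omega>"
      using L2_add[OF L2_scale[OF L2_diff[OF uL uL], of "t + h" t "1 / h"] pL] elim t by simp
    moreover have "AE x in lebesgue_on \<Omega>.
        \<bar>indicat_real A x * p t x\<bar> \<le> \<bar>(u (t + h) x - u t x) / h + p t x\<bar>"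
      using l1_flow_stays_zero[OF flow t, of "t + h"] elim
      by (auto simp: A_def indicator_def)
    ultimately show ?case
      unfolding l2_dist_def by (simp add: l2_norm_mono_AE[OF wL])
  qed
  ultimately have "l2_norm \<Omega> (\<lambda>x. indicat_real A x * p t x) \<le> 0"
    by (rule tendsto_lowerbound) simp
  then have "AE x in lebesgue_on \<Omega>. indicat_real A x * p t x = 0"
    using l2_norm_eq_0_iff[OF wL] l2_norm_nonneg[of \<Omega>] antisym by blast
  then show ?thesis
    using AE_space by eventually_elim (auto simp: A_def)
qed

theorem theorem5p3:
  fixes \<Omega> :: "(real ^ 'n) set"
    and f :: "real ^ 'n \<Rightarrow> real"
    and u p :: "real \<Rightarrow> real ^ 'n \<Rightarrow> real"
  assumes "open \<Omega>"
    and "f \<in> l2_closure \<Omega> (dom_subdifferential \<Omega> (l1_functional \<Omega>))"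
    and "gradient_flow_solution \<Omega> (l1_functional \<Omega>) f u p"
  shows "\<forall>t>0. p t \<in> subdifferential \<Omega> (l1_functional \<Omega>) (p t)"
proof (intro allI impI)
  fix t :: real
  assume t: "0 < t"
  have ut: "u t \<in> L2 \<Omega>" and pt: "p t \<in> subdifferential \<Omega> (l1_functional \<Omega>) (u t)"
    using assms(3) t by (simp_all add: gradient_flow_solution_def)
  have "AE x in lebesgue_on \<Omega>. (p t x)\<^sup>2 = \<bar>p t x\<bar>"
    using l1_subgradient_AE(2)[OF pt ut] l1_flow_velocity_zero[OF assms(3) t]
  proof eventually_elim
    case (elim x)
    show ?case
    proof (cases "u t x = 0")
      case False
      then have "\<bar>p t x\<bar> = 1"
        using elim(1) by (metis abs_abs abs_mult mult_cancel_right1 abs_eq_0)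
      then show ?thesis
        by (metis one_power2 power2_abs)
    qed (use elim(2) in simp)
  qed
  then show "p t \<in> subdifferential \<Omega> (l1_functional \<Omega>) (p t)"
    by (rule l1_subgradient_is_eigenvector[OF pt])
qed

end
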